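(* Let $n\ge 3$ and let $(x_1,y_1),\dots,(x_n,y_n)$ be real data points with $S_{xx}>0$, $S_{yy}>0$ and $S_{xy}>0$. For each $\beta_1$ with $$\frac{S_{xy}}{S_{xx}}<\beta_1<\frac{S_{yy}}{S_{xy}},$$ one has $\beta_1^{mle}(\widetilde{\kappa}(\beta_1))=\beta_1$. In particular, if the fourth moment estimator $\widetilde{\beta}_1$ is well-defined and satisfies $S_{xy}/S_{xx}<\widetilde{\beta}_1<S_{yy}/S_{xy}$, then $\beta_1^{mle}(\widetilde{\kappa}(\widetilde{\beta}_1))=\widetilde{\beta}_1$.
   Context: Notation: $\overline{x}=\frac1n\sum_{i=1}^n x_i$, $\overline{y}=\frac1n\sum_{i=1}^n y_i$, $S_{xx}=\sum_{i=1}^n(x_i-\overline{x})^2$, $S_{yy}=\sum_{i=1}^n(y_i-\overline{y})^2$, $S_{xy}=\sum_{i=1}^n(x_i-\overline{x})(y_i-\overline{y})$, $S_{xxxy}=\sum_{i=1}^n(x_i-\overline{x})^3(y_i-\overline{y})$, $S_{xyyy}=\sum_{i=1}^n(x_i-\overline{x})(y_i-\overline{y})^3$, $\rho=S_{xy}/\sqrt{S_{xx}S_{yy}}$. For an assumed finite ratio $\kappa$ of the error variances (variance of the $y$-error over variance of the $x$-error), the maximum likelihood estimator of the slope in the linear measurement error model is $$\beta_1^{mle}(\kappa)=\frac{(S_{yy}-\kappa S_{xx})+\sqrt{(S_{yy}-\kappa S_{xx})^2+4\kappa\rho^2S_{xx}S_{yy}}}{2\rho\sqrt{S_{xx}S_{yy}}}.$$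 The moment estimator of the error variance ratio, as a function of a slope $\beta_1$, is $$\widetilde{\kappa}(\beta_1)=\frac{S_{yy}-\beta_1\rho\sqrt{S_{xx}S_{yy}}}{S_{xx}-(\rho/\beta_1)\sqrt{S_{xx}S_{yy}}}.$$ The fourth moment estimator of the slope is $$\widetilde{\beta}_1=\sqrt{\frac{S_{xyyy}-3S_{xy}S_{yy}}{S_{xxxy}-3S_{xy}S_{xx}}},$$ well-defined when the denominator is nonzero and the radicand is nonnegative. The interval $S_{xy}/S_{xx}<\beta_1<S_{yy}/S_{xy}$ is the admissible range of slopes, i.e. the range where the moment estimators $\frac1n(S_{xx}-S_{xy}/\beta_1)$ and $\frac1n(S_{yy}-\beta_1S_{xy})$ of the error variances are both positive. *)

theory Defs
  imports Complex_Main
begin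

text \<open>The data points are \<open>(x i, y i)\<close> for \<open>i \<in> {1..n}\<close>; values outside this range are irrelevant.\<close>

definition sample_mean :: "nat \<Rightarrow> (nat \<Rightarrow> real) \<Rightarrow> real" where
  "sample_mean n x = (1 / real n) * (\<Sum>i = 1..n. x i)"

definition S_xx :: "nat \<Rightarrow> (nat \<Rightarrow> real) \<Rightarrow> (nat \<Rightarrow> real) \<Rightarrow> real" where
  "S_xx n x y = (\<Sum>i = 1..n. (x i - sample_mean n x) ^ 2)"

definition S_yy :: "nat \<Rightarrow> (nat \<Rightarrow> real) \<Rightarrow> (nat \<Rightarrow> real) \<Rightarrow> real" where
  "S_yy n x y = (\<Sum>i = 1..n. (y i - sample_mean n y) ^ 2)"

definition S_xy :: "nat \<Rightarrow> (nat \<Rightarrow> real) \<Rightarrow> (nat \<Rightarrow> real) \<Rightarrow> real" where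
  "S_xy n x y = (\<Sum>i = 1..n. (x i - sample_mean n x) * (y i - sample_mean n y))"

definition S_xxxy :: "nat \<Rightarrow> (nat \<Rightarrow> real) \<Rightarrow> (nat \<Rightarrow> real) \<Rightarrow> real" where
  "S_xxxy n x y = (\<Sum>i = 1..n. (x i - sample_mean n x) ^ 3 * (y i - sample_mean n y))"

definition S_xyyy :: "nat \<Rightarrow> (nat \<Rightarrow> real) \<Rightarrow> (nat \<Rightarrow> real) \<Rightarrow> real" where
  "S_xyyy n x y = (\<Sum>i = 1..n. (x i - sample_mean n x) * (y i - sample_mean n y) ^ 3)"

definition correlation :: "nat \<Rightarrow> (nat \<Rightarrow> real) \<Rightarrow> (nat \<Rightarrow> real) \<Rightarrow> real" where
  "correlation n x y = S_xy n x y / sqrt (S_xx n x y * S_yy n x y)"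

text \<open>Maximum likelihood estimator of the slope when the ratio of the variance of the
  \<open>y\<close>-error to the variance of the \<open>x\<close>-error is assumed to be \<open>\<kappa>\<close>.\<close>

definition beta_mle :: "nat \<Rightarrow> (nat \<Rightarrow> real) \<Rightarrow> (nat \<Rightarrow> real) \<Rightarrow> real \<Rightarrow> real" where
  "beta_mle n x y \<kappa> =
     ((S_yy n x y - \<kappa> * S_xx n x y) +
        sqrt ((S_yy n x y - \<kappa> * S_xx n x y) ^ 2
              + 4 * \<kappa> * (correlation n x y) ^ 2 * S_xx n x y * S_yy n x y))
     / (2 * correlation n x y * sqrt (S_xx n x y * S_yy n x y))"

text \<open>Moment estimator of the error variance ratio, as a function of a slope.\<close>

definition kappa_moment :: "nat \<Rightarrow> (nat \<Rightarrow> real) \<Rightarrow> (nat \<Rightarrow> real) \<Rightarrow> real \<Rightarrow> real" where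
  "kappa_moment n x y \<beta> =
     (S_yy n x y - \<beta> * correlation n x y * sqrt (S_xx n x y * S_yy n x y))
     / (S_xx n x y - (correlation n x y / \<beta>) * sqrt (S_xx n x y * S_yy n x y))"

definition admissible_slope :: "nat \<Rightarrow> (nat \<Rightarrow> real) \<Rightarrow> (nat \<Rightarrow> real) \<Rightarrow> real \<Rightarrow> bool" where
  "admissible_slope n x y \<beta> \<longleftrightarrow>
     S_xy n x y / S_xx n x y < \<beta> \<and> \<beta> < S_yy n x y / S_xy n x y"

definition fourth_moment_radicand :: "nat \<Rightarrow> (nat \<Rightarrow> real) \<Rightarrow> (nat \<Rightarrow> real) \<Rightarrow> real" where
  "fourth_moment_radicand n x y =
     (S_xyyy n x y - 3 * S_xy n x y * S_yy n x y)
     / (S_xxxy n x y - 3 * S_xy n x y * S_xx n x y)"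

definition beta_fourth_moment :: "nat \<Rightarrow> (nat \<Rightarrow> real) \<Rightarrow> (nat \<Rightarrow> real) \<Rightarrow> real" where
  "beta_fourth_moment n x y = sqrt (fourth_moment_radicand n x y)"

text \<open>Needed because division and \<^const>\<open>sqrt\<close> are total functions here.\<close>

definition fourth_moment_well_defined :: "nat \<Rightarrow> (nat \<Rightarrow> real) \<Rightarrow> (nat \<Rightarrow> real) \<Rightarrow> bool" where
  "fourth_moment_well_defined n x y \<longleftrightarrow>
     S_xxxy n x y - 3 * S_xy n x y * S_xx n x y \<noteq> 0 \<and> fourth_moment_radicand n x y \<ge> 0"

end

theory Submission
  imports Defs
begin

text \<open>
  Write \<open>a\<close>, \<open>b\<close>, \<open>c\<close> for \<open>S\<^sub>x\<^sub>x\<close>, \<open>S\<^sub>y\<^sub>y\<close>, \<open>S\<^sub>x\<^sub>y\<close>. Since \<open>\<rho> * sqrt (a * b) = c\<close>, both estimators are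
  functions of \<open>a\<close>, \<open>b\<close>, \<open>c\<close> alone: the maximum likelihood slope for the variance ratio \<open>\<kappa>\<close> is the
  larger root \<open>t\<close> of \<open>c * t\<^sup>2 - (b - \<kappa> * a) * t - \<kappa> * c = 0\<close>. The roots of this quadratic have
  product \<open>-\<kappa>\<close>, so for \<open>\<kappa> > 0\<close> the larger one is its only positive root. The moment estimator
  is the ratio \<open>\<kappa>\<close> that solves \<open>b - \<beta> * c = \<kappa> * (a - c / \<beta>)\<close>, and multiplying this equation by \<open>\<beta>\<close>
  shows that it says precisely that \<open>\<beta>\<close> is a root. On the admissible range \<open>\<beta>\<close> and both estimated
  error variances are positive, hence so is \<open>\<kappa>\<close>, and \<open>\<beta>\<close> is the root chosen by the maximum
  likelihood estimator. The fourth moment estimator enters only as one particular admissible slope.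
\<close>

lemma beta_mle_eq_S_xy:
  assumes "S_xx n x y > 0" "S_yy n x y > 0"
  shows "beta_mle n x y \<kappa> =
    ((S_yy n x y - \<kappa> * S_xx n x y)
       + sqrt ((S_yy n x y - \<kappa> * S_xx n x y)\<^sup>2 + 4 * \<kappa> * (S_xy n x y)\<^sup>2))
    / (2 * S_xy n x y)"
proof -
  have pos: "S_xx n x y * S_yy n x y > 0"
    using assms by simp
  have "correlation n x y * sqrt (S_xx n x y * S_yy n x y) = S_xy n x y"
    using pos assms by (simp add: correlation_def)
  moreover have "(correlation n x y)\<^sup>2 * (S_xx n x y * S_yy n x y) = (S_xy n x y)\<^sup>2"
    using pos assms by (simp add: correlation_def power_divide)
  ultimately show ?thesis
    by (simp add: beta_mle_def mult.assoc)
qed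

lemma kappa_moment_eq_S_xy:
  assumes "S_xx n x y > 0" "S_yy n x y > 0"
  shows "kappa_moment n x y \<beta> =
    (S_yy n x y - \<beta> * S_xy n x y) / (S_xx n x y - S_xy n x y / \<beta>)"
  using assms by (simp add: kappa_moment_def correlation_def)

text \<open>
  The equation in the second premise turns the discriminant \<open>(b - \<kappa> * a)\<^sup>2 + 4 * \<kappa> * c\<^sup>2\<close> into the perfect
  square \<open>(c * (\<beta> + \<kappa> / \<beta>))\<^sup>2\<close>; the signs of \<open>\<beta>\<close>, \<open>c\<close> and \<open>\<kappa>\<close> decide which square root is taken.
\<close>

lemma larger_quadratic_root_eq:
  fixes a b c \<beta> \<kappa> :: real
  assumes "c > 0" "\<beta> > 0" "\<kappa> \<ge> 0"
    and root: "b - \<beta> * c = \<kappa> * (a - c / \<beta>)"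
  shows "((b - \<kappa> * a) + sqrt ((b - \<kappa> * a)\<^sup>2 + 4 * \<kappa> * c\<^sup>2)) / (2 * c) = \<beta>"
proof -
  have lin: "b - \<kappa> * a = c * (\<beta> - \<kappa> / \<beta>)"
    using root by (simp add: algebra_simps)
  have "(b - \<kappa> * a)\<^sup>2 + 4 * \<kappa> * c\<^sup>2 = (c * (\<beta> + \<kappa> / \<beta>))\<^sup>2"
    unfolding lin using \<open>\<beta> > 0\<close> by (simp add: field_simps power2_eq_square)
  moreover have "c * (\<beta> + \<kappa> / \<beta>) \<ge> 0"
    using assms by simp
  ultimately have "sqrt ((b - \<kappa> * a)\<^sup>2 + 4 * \<kappa> * c\<^sup>2) = c * (\<beta> + \<kappa> / \<beta>)"
    by simp
  then show ?thesis
    unfolding lin using \<open>c > 0\<close> by (simp add: field_simps)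
qed

lemma beta_mle_kappa_moment:
  assumes S: "S_xx n x y > 0" "S_yy n x y > 0" "S_xy n x y > 0"
    and adm: "admissible_slope n x y \<beta>"
  shows "beta_mle n x y (kappa_moment n x y \<beta>) = \<beta>"
proof -
  define \<kappa> where "\<kappa> = kappa_moment n x y \<beta>"
  have lower: "S_xy n x y / S_xx n x y < \<beta>" and upper: "\<beta> < S_yy n x y / S_xy n x y"
    using adm by (simp_all add: admissible_slope_def)
  have "S_xy n x y / S_xx n x y > 0"
    using S by simp
  with lower have "\<beta> > 0"
    by linarith
  have x_error: "S_xx n x y - S_xy n x y / \<beta> > 0"
    using lower S \<open>\<beta> > 0\<close> by (simp add: field_simps)
  have y_error: "S_yy n x y - \<beta> * S_xy n x y > 0"
    using upper S by (simp add: field_simps)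
  have \<kappa>: "\<kappa> = (S_yy n x y - \<beta> * S_xy n x y) / (S_xx n x y - S_xy n x y / \<beta>)"
    unfolding \<kappa>_def using S(1,2) by (rule kappa_moment_eq_S_xy)
  have "\<kappa> \<ge> 0"
    unfolding \<kappa> using x_error y_error by simp
  moreover have "S_yy n x y - \<beta> * S_xy n x y = \<kappa> * (S_xx n x y - S_xy n x y / \<beta>)"
    unfolding \<kappa> using x_error by simp
  ultimately have "beta_mle n x y \<kappa> = \<beta>"
    unfolding beta_mle_eq_S_xy[OF S(1,2)]
    using S(3) \<open>\<beta> > 0\<close> by (intro larger_quadratic_root_eq)
  then show ?thesis
    by (simp add: \<kappa>_def)
qed

theorem proposition3:
  fixes n :: nat and x y :: "nat \<Rightarrow> real"
  assumes "n \<ge> 3"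
    and "S_xx n x y > 0" and "S_yy n x y > 0" and "S_xy n x y > 0"
  shows "(\<forall>\<beta>::real. admissible_slope n x y \<beta> \<longrightarrow>
            beta_mle n x y (kappa_moment n x y \<beta>) = \<beta>) \<and>
         (fourth_moment_well_defined n x y \<and>
          admissible_slope n x y (beta_fourth_moment n x y) \<longrightarrow>
            beta_mle n x y (kappa_moment n x y (beta_fourth_moment n x y))
              = beta_fourth_moment n x y)"
  using beta_mle_kappa_moment[OF assms(2-4)] by blast

end
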